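(* Let $\mathscr G_{\mathbf{WSO}}$ be the set of all finite node-labeled digraphs that are weakly connected, simple and oriented. Define $d_e:\mathscr G_{\mathbf{WSO}}\times\mathscr G_{\mathbf{WSO}}\to[0,1]$ by $$d_e(G,G')=1-\frac{\operatorname{DMCES}(G,G')}{\max(|\mathcal D|,|\mathcal D'|)},$$ where $\mathcal D,\mathcal D'$ are the edge sets of $G,G'$. Then $d_e$ is a metric on $\mathscr G_{\mathbf{WSO}}$.
   Context: A node-labeled digraph $G=(V,\mathcal D,\ell_v)$ consists of a finite node set $V$, directed edges $\mathcal D\subseteq V\times V$, and a node-labeling function $\ell_v$ on $V$. Weakly connected: the underlying undirected graph is connected. Simple: no self-loops and no parallel edges with the same source and target. Oriented: no pair $(u,v),(v,u)$ both in $\mathcal D$. Graphs are considered up to isomorphism, where an isomorphism of node-labeled digraphs is a label-preserving bijection $\gamma:V\to V'$ with $(u,v)\in\mathcal D$ iff $(\gamma(u),\gamma(v))\in\mathcal D'$. For node-labeled digraphs $G=(V,\mathcal D,\ell_v)$, $G'=(V',\mathcal D',\ell'_v)$: a feasible solution is a pair $(U,\phi)$ with $U\subseteq V$ and $\phi:U\to V'$ injective with $\ell'_v(\phi(u))=\ell_v(u)$ for all $u\in U$; its score is $\mathcal P(U,\phi)=|\{(v_1,v_2)\in U\times U:(v_1,v_2)\in\mathcal D\text{ and }(\phi(v_1),\phi(v_2))\in\mathcal D'\}|$; and $\operatorname{DMCES}(G,G')$ is the maximum score over all feasible solutions.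
   Formalization: For two edgeless graphs (single nodes) the formula for d_e is 0/0 and undefined; there d_e is set to 0 if the graphs are isomorphic and to 1 otherwise. Elsewhere d_e is the given formula, and the metric is on isomorphism classes of nonempty graphs. *)

theory Defs
  imports
    "HOL-Analysis.Abstract_Metric_Spaces"
    "Graph_Theory.Graph_Theory"
begin

record ('v, 'l) labeled_digraph =
  dgraph :: "'v pair_pre_digraph"
  nlabel :: "'v \<Rightarrow> 'l"

abbreviation nodes :: "('v, 'l) labeled_digraph \<Rightarrow> 'v set" where
  "nodes G \<equiv> pverts (dgraph G)"

abbreviation edges :: "('v, 'l) labeled_digraph \<Rightarrow> ('v \<times> 'v) set" where
  "edges G \<equiv> parcs (dgraph G)"

definition oriented :: "('v, 'l) labeled_digraph \<Rightarrow> bool" where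
  "oriented G \<longleftrightarrow> (\<forall>u v. (u, v) \<in> edges G \<longrightarrow> (v, u) \<notin> edges G)"

text \<open>
  \<^const>\<open>pair_digraph\<close> says: finite, edges between nodes, no loops; parallel edges cannot occur
  because the edges form a set of pairs.  \<^const>\<open>Digraph_Component.connected\<close> is connectedness of
  the underlying undirected graph, which includes that there is at least one node.
\<close>

definition G_WSO :: "('v, 'l) labeled_digraph set" where
  "G_WSO = {G. pair_digraph (dgraph G) \<and>
               Digraph_Component.connected (with_proj (dgraph G)) \<and>
               oriented G}"

definition labeled_iso ::
    "('v, 'l) labeled_digraph \<Rightarrow> ('w, 'l) labeled_digraph \<Rightarrow> bool" where
  "labeled_iso G G' \<longleftrightarrow> (\<exists>\<gamma>. bij_betw \<gamma> (nodes G) (nodes G') \<and>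
      (\<forall>u\<in>nodes G. nlabel G' (\<gamma> u) = nlabel G u) \<and>
      (\<forall>u\<in>nodes G. \<forall>v\<in>nodes G. (u, v) \<in> edges G \<longleftrightarrow> (\<gamma> u, \<gamma> v) \<in> edges G'))"

text \<open>
  The partial map of a feasible solution is a total function of which only the values on \<open>U\<close> matter.
\<close>

definition feasible ::
    "('v, 'l) labeled_digraph \<Rightarrow> ('w, 'l) labeled_digraph \<Rightarrow> 'v set \<Rightarrow> ('v \<Rightarrow> 'w) \<Rightarrow> bool" where
  "feasible G G' U \<phi> \<longleftrightarrow>
     U \<subseteq> nodes G \<and> \<phi> ` U \<subseteq> nodes G' \<and> inj_on \<phi> U \<and> (\<forall>u\<in>U. nlabel G' (\<phi> u) = nlabel G u)"

definition score ::
    "('v, 'l) labeled_digraph \<Rightarrow> ('w, 'l) labeled_digraph \<Rightarrow> 'v set \<Rightarrow> ('v \<Rightarrow> 'w) \<Rightarrow> nat" where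
  "score G G' U \<phi> =
     card {(v\<^sub>1, v\<^sub>2) \<in> U \<times> U. (v\<^sub>1, v\<^sub>2) \<in> edges G \<and> (\<phi> v\<^sub>1, \<phi> v\<^sub>2) \<in> edges G'}"

definition DMCES :: "('v, 'l) labeled_digraph \<Rightarrow> ('w, 'l) labeled_digraph \<Rightarrow> nat" where
  "DMCES G G' = Max {score G G' U \<phi> | U \<phi>. feasible G G' U \<phi>}"

text \<open>
  If both graphs are edgeless (in \<open>G_WSO\<close>: both are single nodes), the quotient in the usual formula
  is \<open>0 / 0\<close>.  There it is read as 1 for isomorphic graphs and as 0 otherwise.
\<close>

definition d_e :: "('v, 'l) labeled_digraph \<Rightarrow> ('w, 'l) labeled_digraph \<Rightarrow> real" where
  "d_e G G' =
     (if edges G = {} \<and> edges G' = {} then (if labeled_iso G G' then 0 else 1)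
      else 1 - real (DMCES G G') / real (max (card (edges G)) (card (edges G'))))"

definition iso_rel :: "('v, 'l) labeled_digraph rel" where
  "iso_rel = {(G, G'). G \<in> G_WSO \<and> G' \<in> G_WSO \<and> labeled_iso G G'}"

lemma equiv_iso_rel: "equiv G_WSO (iso_rel :: ('v, 'l) labeled_digraph rel)"
proof (rule equivI)
  show "iso_rel \<subseteq> G_WSO \<times> (G_WSO :: ('v, 'l) labeled_digraph set)"
    by (auto simp: iso_rel_def)
  have "labeled_iso G G" for G :: "('v, 'l) labeled_digraph"
    unfolding labeled_iso_def by (rule exI[of _ id]) auto
  then show "refl_on G_WSO (iso_rel :: ('v, 'l) labeled_digraph rel)"
    by (auto simp: refl_on_def iso_rel_def)
  show "sym (iso_rel :: ('v, 'l) labeled_digraph rel)"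
  proof (rule symI)
    fix G H :: "('v, 'l) labeled_digraph"
    assume GH: "(G, H) \<in> iso_rel"
    then obtain \<gamma> where b: "bij_betw \<gamma> (nodes G) (nodes H)"
      and l: "\<forall>u\<in>nodes G. nlabel H (\<gamma> u) = nlabel G u"
      and e: "\<forall>u\<in>nodes G. \<forall>v\<in>nodes G. (u, v) \<in> edges G \<longleftrightarrow> (\<gamma> u, \<gamma> v) \<in> edges H"
      by (auto simp: iso_rel_def labeled_iso_def)
    let ?i = "inv_into (nodes G) \<gamma>"
    have i: "?i u \<in> nodes G" "\<gamma> (?i u) = u" if "u \<in> nodes H" for u
      using b that by (auto simp: bij_betw_def inv_into_into f_inv_into_f)
    have "labeled_iso H G"
      unfolding labeled_iso_def
      using bij_betw_inv_into[OF b] i l e by (intro exI[of _ ?i]) metis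
    with GH show "(H, G) \<in> iso_rel" by (auto simp: iso_rel_def)
  qed
  show "trans (iso_rel :: ('v, 'l) labeled_digraph rel)"
  proof (rule transI)
    fix G H K :: "('v, 'l) labeled_digraph"
    assume GH: "(G, H) \<in> iso_rel" and HK: "(H, K) \<in> iso_rel"
    from GH obtain \<gamma> where g: "bij_betw \<gamma> (nodes G) (nodes H)"
      "\<forall>u\<in>nodes G. nlabel H (\<gamma> u) = nlabel G u"
      "\<forall>u\<in>nodes G. \<forall>v\<in>nodes G. (u, v) \<in> edges G \<longleftrightarrow> (\<gamma> u, \<gamma> v) \<in> edges H"
      by (auto simp: iso_rel_def labeled_iso_def)
    from HK obtain \<delta> where d: "bij_betw \<delta> (nodes H) (nodes K)"
      "\<forall>u\<in>nodes H. nlabel K (\<delta> u) = nlabel H u"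
      "\<forall>u\<in>nodes H. \<forall>v\<in>nodes H. (u, v) \<in> edges H \<longleftrightarrow> (\<delta> u, \<delta> v) \<in> edges K"
      by (auto simp: iso_rel_def labeled_iso_def)
    have m: "\<gamma> u \<in> nodes H" if "u \<in> nodes G" for u
      using g(1) that by (auto simp: bij_betw_def)
    have "labeled_iso G K"
      unfolding labeled_iso_def
      using bij_betw_trans[OF g(1) d(1)] g(2,3) d(2,3) m by (intro exI[of _ "\<delta> \<circ> \<gamma>"]) auto
    with GH HK show "(G, K) \<in> iso_rel" by (auto simp: iso_rel_def)
  qed
qed

definition iso_class :: "('v, 'l) labeled_digraph \<Rightarrow> ('v, 'l) labeled_digraph set" where
  "iso_class G = iso_rel `` {G}"

definition WSO_classes :: "('v, 'l) labeled_digraph set set" where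
  "WSO_classes = G_WSO // iso_rel"

text \<open>
  The value 0 outside \<open>WSO_classes\<close> is arbitrary; it is there because \<^locale>\<open>Metric_space\<close> demands
  nonnegativity and symmetry on the whole type.
\<close>

definition class_dist ::
    "('v, 'l) labeled_digraph set \<Rightarrow> ('v, 'l) labeled_digraph set \<Rightarrow> real" where
  "class_dist X Y =
     (if X \<in> WSO_classes \<and> Y \<in> WSO_classes then d_e (SOME G. G \<in> X) (SOME G'. G' \<in> Y) else 0)"

end

theory Submission
  imports Defs
begin

text \<open>
  A feasible solution from \<open>G\<close> to \<open>H\<close> embeds its matched edges injectively into the edges of \<open>H\<close>.
  Composing optimal solutions for \<open>G, H\<close> and \<open>H, K\<close> keeps every edge of \<open>H\<close> used by both, so
  inclusion-exclusion gives \<open>DMCES G H + DMCES H K \<le> |edges H| + DMCES G K\<close>, and the triangle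
  inequality follows by arithmetic.  If \<open>d_e G H = 0\<close> and there are edges, an optimal solution
  matches all edges of both graphs; by weak connectedness every node is an endpoint of an edge, so
  the solution is defined on all nodes, is onto, and is an isomorphism.
\<close>

section \<open>Matched edges\<close>

text \<open>\<open>score\<close> keeps only a number; the set itself is named because its images,
  unions and intersections inside an edge set are compared below.\<close>

definition matched ::
    "('v, 'l) labeled_digraph \<Rightarrow> ('w, 'l) labeled_digraph \<Rightarrow> 'v set \<Rightarrow> ('v \<Rightarrow> 'w) \<Rightarrow> ('v \<times> 'v) set" where
  "matched G H U \<phi> = {(u, v) \<in> U \<times> U. (u, v) \<in> edges G \<and> (\<phi> u, \<phi> v) \<in> edges H}"

lemma score_eq_card_matched: "score G H U \<phi> = card (matched G H U \<phi>)"
  by (simp add: score_def matched_def)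

lemma matched_subset_edges: "matched G H U \<phi> \<subseteq> edges G"
  by (auto simp: matched_def)

lemma image_matched_subset_edges: "map_prod \<phi> \<phi> ` matched G H U \<phi> \<subseteq> edges H"
  by (auto simp: matched_def)

lemma inj_on_matched: "inj_on \<phi> U \<Longrightarrow> inj_on (map_prod \<phi> \<phi>) (matched G H U \<phi>)"
  by (auto simp: matched_def inj_on_def)

lemma card_image_matched:
  "feasible G H U \<phi> \<Longrightarrow> card (map_prod \<phi> \<phi> ` matched G H U \<phi>) = score G H U \<phi>"
  by (simp add: score_eq_card_matched card_image inj_on_matched feasible_def)

section \<open>The maximum score: attainment, bounds, symmetry and composition\<close>

lemma finite_scores:
  assumes "finite (edges G)"
  shows "finite {score G H U \<phi> | U \<phi>. feasible G H U \<phi>}"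
proof (rule finite_subset)
  show "{score G H U \<phi> | U \<phi>. feasible G H U \<phi>} \<subseteq> {..card (edges G)}"
    using assms by (auto simp: score_eq_card_matched intro!: card_mono matched_subset_edges)
qed simp

lemma score_le_DMCES:
  "finite (edges G) \<Longrightarrow> feasible G H U \<phi> \<Longrightarrow> score G H U \<phi> \<le> DMCES G H"
  unfolding DMCES_def by (rule Max_ge) (auto intro: finite_scores)

lemma DMCES_attained:
  assumes "finite (edges G)"
  obtains U \<phi> where "feasible G H U \<phi>" "score G H U \<phi> = DMCES G H"
proof -
  \<comment> \<open>The empty partial map makes the set of scores nonempty, so its
    \<open>Max\<close> is attained.\<close>
  have "feasible G H {} \<phi>" for \<phi>
    by (simp add: feasible_def)
  then have "DMCES G H \<in> {score G H U \<phi> | U \<phi>. feasible G H U \<phi>}"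
    unfolding DMCES_def by (intro Max_in finite_scores assms) blast
  then show thesis
    using that by auto
qed

lemma DMCES_le_left: "finite (edges G) \<Longrightarrow> DMCES G H \<le> card (edges G)"
  by (metis DMCES_attained score_eq_card_matched card_mono matched_subset_edges)

lemma DMCES_le_right:
  assumes "finite (edges G)" "finite (edges H)"
  shows "DMCES G H \<le> card (edges H)"
  using assms
  by (metis DMCES_attained card_image_matched card_mono image_matched_subset_edges)

text \<open>The inverse of an optimal partial map matches at least the images of the matched edges,
  and injectivity keeps their number. Exchanging \<open>G\<close> and \<open>H\<close> then gives
  equality.\<close>

lemma DMCES_commute_le:
  assumes G: "finite (edges G)" and H: "finite (edges H)"
  shows "DMCES G H \<le> DMCES H G"
proof -
  obtain U \<phi> where f: "feasible G H U \<phi>" and s: "score G H U \<phi> = DMCES G H"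
    using DMCES_attained[OF G] .
  let ?i = "inv_into U \<phi>"
  have i: "?i (\<phi> u) = u" if "u \<in> U" for u
    using f that by (simp add: feasible_def)
  have "feasible H G (\<phi> ` U) ?i"
    using f i by (auto simp: feasible_def inj_on_inv_into)
  moreover have "map_prod \<phi> \<phi> ` matched G H U \<phi> \<subseteq> matched H G (\<phi> ` U) ?i"
    using i by (auto simp: matched_def)
  then have "score G H U \<phi> \<le> score H G (\<phi> ` U) ?i"
    unfolding card_image_matched[OF f, symmetric] score_eq_card_matched[of H]
    by (rule card_mono[OF finite_subset[OF matched_subset_edges H]])
  ultimately show ?thesis
    using s score_le_DMCES[OF H] by (metis order_trans)
qed

lemma DMCES_commute:
  "finite (edges G) \<Longrightarrow> finite (edges H) \<Longrightarrow> DMCES G H = DMCES H G"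
  by (simp add: DMCES_commute_le antisym)

lemma DMCES_add_le:
  assumes G: "finite (edges G)" and H: "finite (edges H)"
  shows "DMCES G H + DMCES H K \<le> card (edges H) + DMCES G K"
proof -
  obtain U \<phi> where f: "feasible G H U \<phi>" and s: "score G H U \<phi> = DMCES G H"
    using DMCES_attained[OF G] .
  obtain W \<psi> where f': "feasible H K W \<psi>" and s': "score H K W \<psi> = DMCES H K"
    using DMCES_attained[OF H] .
  let ?A = "map_prod \<phi> \<phi> ` matched G H U \<phi>" and ?B = "matched H K W \<psi>"
  \<comment> \<open>The domain of the composite: the nodes of \<open>U\<close> that
    \<open>\<phi>\<close> sends into \<open>W\<close>.\<close>
  let ?X = "U \<inter> \<phi> -` W"
  let ?C = "matched G K ?X (\<psi> \<circ> \<phi>)"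
  have fin: "finite ?A" "finite ?B" "finite ?C"
    using H G by (auto intro: finite_subset[OF image_matched_subset_edges]
        finite_subset[OF matched_subset_edges])
  have "feasible G K ?X (\<psi> \<circ> \<phi>)"
    using f f' by (auto simp: feasible_def inj_on_def image_subset_iff)
  then have "card ?C \<le> DMCES G K"
    using score_le_DMCES[OF G] by (metis score_eq_card_matched)
  \<comment> \<open>A common element is the image of a matched edge \<open>(u, v)\<close> of
    \<open>G\<close>; membership in \<open>?B\<close> puts its endpoints in \<open>W\<close> and
    sends it to an edge of \<open>K\<close>, so the composite matches \<open>(u, v)\<close>.\<close>
  moreover have "?A \<inter> ?B \<subseteq> map_prod \<phi> \<phi> ` ?C"
    by (force simp: matched_def)
  then have "card (?A \<inter> ?B) \<le> card ?C"
    using fin by (meson card_image_le card_mono finite_imageI le_trans)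
  moreover have "card (?A \<union> ?B) \<le> card (edges H)"
    using H by (intro card_mono Un_least image_matched_subset_edges matched_subset_edges)
  moreover have "card ?A + card ?B = card (?A \<union> ?B) + card (?A \<inter> ?B)"
    using fin by (intro card_Un_Int)
  ultimately show ?thesis
    using s s' card_image_matched[OF f] by (simp add: score_eq_card_matched)
qed

section \<open>Weakly connected oriented digraphs\<close>

lemma G_WSO_finite_edges: "G \<in> G_WSO \<Longrightarrow> finite (edges G)"
  by (auto simp: G_WSO_def pair_digraph_def intro: pair_fin_digraph.pair_finite_arcs)

lemma G_WSO_edges_subset:
  assumes "G \<in> G_WSO"
  shows "edges G \<subseteq> nodes G \<times> nodes G"
proof -
  interpret pair_digraph "dgraph G"
    using assms by (simp add: G_WSO_def)
  show ?thesis
    using arc_fst_in_verts arc_snd_in_verts by force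
qed

text \<open>Connectedness joins every node to an endpoint of one fixed edge; either the walk is
  trivial or its first step is an edge at the node.\<close>

lemma G_WSO_nodes_eq_endpoints:
  assumes "G \<in> G_WSO" and "edges G \<noteq> {}"
  shows "nodes G = fst ` edges G \<union> snd ` edges G"
proof
  show "fst ` edges G \<union> snd ` edges G \<subseteq> nodes G"
    using G_WSO_edges_subset[OF assms(1)] by force
  show "nodes G \<subseteq> fst ` edges G \<union> snd ` edges G"
  proof
    fix u assume u: "u \<in> nodes G"
    obtain a b where ab: "(a, b) \<in> edges G"
      using assms(2) by auto
    then have "a \<in> nodes G"
      using G_WSO_edges_subset[OF assms(1)] by auto
    then have "u \<rightarrow>\<^sup>*\<^bsub>with_proj (mk_symmetric (with_proj (dgraph G)))\<^esub> a"
      using assms(1) u by (auto simp: G_WSO_def connected_def strongly_connected_def)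
    then show "u \<in> fst ` edges G \<union> snd ` edges G"
    proof (cases rule: pre_digraph.converse_reachable_cases[consumes 1, case_names base step])
      case base
      then show ?thesis using ab by force
    next
      \<comment> \<open>The first arc, from \<open>u\<close> to \<open>w\<close>, lies in the
        symmetric closure, so it or its reverse is an edge.\<close>
      case (step w)
      then show ?thesis by (force simp: parcs_mk_symmetric)
    qed
  qed
qed

section \<open>The distance\<close>

lemma labeled_iso_sym:
  fixes G H :: "('v, 'l) labeled_digraph"
  assumes "G \<in> G_WSO" "H \<in> G_WSO" "labeled_iso G H"
  shows "labeled_iso H G"
proof -
  have "sym (iso_rel :: ('v, 'l) labeled_digraph rel)"
    using equiv_iso_rel by (auto elim: equivE)
  then show ?thesis
    using assms symD[of iso_rel G H] by (simp add: iso_rel_def)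
qed

lemma labeled_iso_trans:
  fixes G H K :: "('v, 'l) labeled_digraph"
  assumes "G \<in> G_WSO" "H \<in> G_WSO" "K \<in> G_WSO" "labeled_iso G H" "labeled_iso H K"
  shows "labeled_iso G K"
proof -
  have "trans (iso_rel :: ('v, 'l) labeled_digraph rel)"
    using equiv_iso_rel by (auto elim: equivE)
  then show ?thesis
    using assms transD[of iso_rel G H K] by (simp add: iso_rel_def)
qed

lemma d_e_bounds:
  assumes "finite (edges G)"
  shows "0 \<le> d_e G H" "d_e G H \<le> 1"
proof -
  have "real (DMCES G H) \<le> real (max (card (edges G)) (card (edges H)))"
    using DMCES_le_left[OF assms, of H] by linarith
  then show "0 \<le> d_e G H" "d_e G H \<le> 1"
    by (auto simp: d_e_def divide_le_eq_1)
qed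

lemma d_e_commute:
  fixes G H :: "('v, 'l) labeled_digraph"
  assumes "G \<in> G_WSO" "H \<in> G_WSO"
  shows "d_e G H = d_e H G"
  using assms labeled_iso_sym[of G H] labeled_iso_sym[of H G]
  by (auto simp: d_e_def DMCES_commute[of G H] G_WSO_finite_edges max.commute)

section \<open>Distance zero and isomorphism\<close>

lemma DMCES_eq_max_if_labeled_iso:
  fixes G H :: "('v, 'l) labeled_digraph"
  assumes G: "G \<in> G_WSO" and H: "H \<in> G_WSO" and "labeled_iso G H"
  shows "DMCES G H = max (card (edges G)) (card (edges H))"
proof -
  \<comment> \<open>Generalised over both graphs, so that it also applies to the reversed
    isomorphism: an isomorphism is itself a feasible solution matching all edges.\<close>
  have le: "card (edges G) \<le> DMCES G H"
    if G: "G \<in> G_WSO" and iso: "labeled_iso G H" for G H :: "('v, 'l) labeled_digraph"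
  proof -
    obtain \<gamma> where \<gamma>: "bij_betw \<gamma> (nodes G) (nodes H)"
      "\<forall>u\<in>nodes G. nlabel H (\<gamma> u) = nlabel G u"
      "\<forall>u\<in>nodes G. \<forall>v\<in>nodes G. (u, v) \<in> edges G \<longleftrightarrow> (\<gamma> u, \<gamma> v) \<in> edges H"
      using iso by (auto simp: labeled_iso_def)
    have "feasible G H (nodes G) \<gamma>"
      using \<gamma> by (auto simp: feasible_def bij_betw_def)
    moreover have "matched G H (nodes G) \<gamma> = edges G"
      using \<gamma>(3) G_WSO_edges_subset[OF G] by (auto simp: matched_def)
    ultimately show ?thesis
      using score_le_DMCES[OF G_WSO_finite_edges[OF G]] by (metis score_eq_card_matched)
  qed
  have "card (edges H) \<le> DMCES G H"
    using le[OF H labeled_iso_sym[OF assms]] DMCES_commute G H G_WSO_finite_edges by metis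
  then show ?thesis
    using le[OF G assms(3)] DMCES_le_left[OF G_WSO_finite_edges[OF G], of H] by linarith
qed

lemma labeled_iso_if_DMCES_eq_max:
  assumes G: "G \<in> G_WSO" and H: "H \<in> G_WSO" and ne: "edges G \<noteq> {} \<or> edges H \<noteq> {}"
    and eq: "DMCES G H = max (card (edges G)) (card (edges H))"
  shows "labeled_iso G H"
proof -
  note fin = G_WSO_finite_edges[OF G] G_WSO_finite_edges[OF H]
  \<comment> \<open>\<open>DMCES\<close> is bounded by each edge count, so reaching the maximum
    forces the two counts to agree.\<close>
  have cards: "DMCES G H = card (edges G)" "DMCES G H = card (edges H)"
    using eq DMCES_le_left[OF fin(1), of H] DMCES_le_right[OF fin] by linarith+
  then have ne': "edges G \<noteq> {}" "edges H \<noteq> {}"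
    using ne fin by auto
  obtain U \<phi> where f: "feasible G H U \<phi>" and s: "score G H U \<phi> = DMCES G H"
    using DMCES_attained[OF fin(1)] .
  have m: "matched G H U \<phi> = edges G"
    using s cards(1) fin(1)
    by (intro card_subset_eq matched_subset_edges) (auto simp: score_eq_card_matched)
  have im: "map_prod \<phi> \<phi> ` edges G = edges H"
    using s cards(2) fin(2) card_image_matched[OF f] image_matched_subset_edges[of \<phi> G H U]
    unfolding m by (intro card_subset_eq) auto
  have U: "U = nodes G"
  proof
    show "U \<subseteq> nodes G" using f by (simp add: feasible_def)
    have "edges G \<subseteq> U \<times> U" using m by (auto simp: matched_def)
    then show "nodes G \<subseteq> U"
      unfolding G_WSO_nodes_eq_endpoints[OF G ne'(1)] by force
  qed
  have "\<phi> ` nodes G = nodes H"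
    unfolding G_WSO_nodes_eq_endpoints[OF G ne'(1)] G_WSO_nodes_eq_endpoints[OF H ne'(2)]
      im[symmetric] by (simp add: image_Un image_image)
  then have "bij_betw \<phi> (nodes G) (nodes H)"
    using f U by (simp add: feasible_def bij_betw_def)
  moreover have "(u, v) \<in> edges G \<longleftrightarrow> (\<phi> u, \<phi> v) \<in> edges H"
    if "u \<in> nodes G" "v \<in> nodes G" for u v
  proof
    assume "(u, v) \<in> edges G"
    then show "(\<phi> u, \<phi> v) \<in> edges H" using im by force
  next
    \<comment> \<open>Edges are reflected because every edge of \<open>H\<close> is the image of an
      edge of \<open>G\<close> and \<open>\<phi>\<close> is injective.\<close>
    assume "(\<phi> u, \<phi> v) \<in> edges H"
    then obtain a b where ab: "(a, b) \<in> edges G" "\<phi> a = \<phi> u" "\<phi> b = \<phi> v"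
      using im by force
    moreover have "a \<in> nodes G" "b \<in> nodes G"
      using ab(1) G_WSO_edges_subset[OF G] by auto
    ultimately show "(u, v) \<in> edges G"
      using f U that by (metis feasible_def inj_onD)
  qed
  ultimately show ?thesis
    using f U unfolding labeled_iso_def feasible_def by blast
qed

lemma d_e_eq_0_iff:
  fixes G H :: "('v, 'l) labeled_digraph"
  assumes "G \<in> G_WSO" "H \<in> G_WSO"
  shows "d_e G H = 0 \<longleftrightarrow> labeled_iso G H"
proof (cases "edges G = {} \<and> edges H = {}")
  case True
  then show ?thesis by (simp add: d_e_def)
next
  case False
  then have "max (card (edges G)) (card (edges H)) \<noteq> 0"
    using G_WSO_finite_edges[OF assms(1)] G_WSO_finite_edges[OF assms(2)]
    by (auto simp: max_def split: if_splits)
  then have "d_e G H = 0 \<longleftrightarrow> DMCES G H = max (card (edges G)) (card (edges H))"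
    using False by (auto simp: d_e_def simp del: of_nat_max)
  then show ?thesis
    using DMCES_eq_max_if_labeled_iso[OF assms] labeled_iso_if_DMCES_eq_max[OF assms] False
    by blast
qed

section \<open>The triangle inequality\<close>

text \<open>Here \<open>g\<close>, \<open>h\<close>, \<open>k\<close> stand for the edge counts of
  three graphs and \<open>a\<close>, \<open>b\<close>, \<open>c\<close> for the \<open>DMCES\<close>
  of the pairs GH, HK, GK. The argument splits on which edge count is largest.\<close>

lemma overlap_triangle:
  fixes a b c g h k :: real
  assumes "c \<ge> 0" "a + b \<le> h + c" "0 \<le> a" "a \<le> h" "0 \<le> b" "b \<le> h"
    and pos: "max g h > 0" "max h k > 0" "max g k > 0"
  shows "a / max g h + b / max h k \<le> 1 + c / max g k"
proof -
  \<comment> \<open>With \<open>g\<close> largest, changing the denominator of \<open>b\<close> from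
    \<open>?m\<close> to \<open>g\<close> costs at most \<open>g - ?m\<close>, hence at most
    \<open>g - h\<close>, since \<open>b / ?m\<close> is at most 1.\<close>
  have large: "a / g + b / max h k \<le> 1 + c / g"
    if "h \<le> g" "k \<le> g" "g > 0" "a + b \<le> h + c" "0 \<le> b" "b \<le> h" "max h k > 0" for a b g h k :: real
  proof -
    let ?m = "max h k"
    have "b / ?m * (g - ?m) \<le> 1 * (g - ?m)"
      using that by (intro mult_right_mono) auto
    then have "b / ?m * g - b \<le> g - h"
      using that by (simp add: right_diff_distrib)
    then have "a + b / ?m * g \<le> g + c"
      using that by linarith
    then have "(a + b / ?m * g) / g \<le> (g + c) / g"
      using that(3) by (intro divide_right_mono) auto
    then show ?thesis
      using that(3) by (simp add: add_divide_distrib)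
  qed
  consider "g \<le> h" "k \<le> h" | "h \<le> g" "k \<le> g" | "h \<le> k" "g \<le> k"
    by linarith
  then show ?thesis
  proof cases
    case 1
    then have "(a + b) / h \<le> (h + c) / h"
      using pos assms(2) by (intro divide_right_mono) auto
    then have "a / h + b / h \<le> 1 + c / h"
      using 1 pos by (simp add: add_divide_distrib)
    also have "c / h \<le> c / max g k"
      using 1 assms(1) pos by (intro divide_left_mono) auto
    finally show ?thesis
      using 1 by (simp add: max_def)
  next
    case 2
    then show ?thesis
      using large[of h g k a b] pos assms by (simp add: max_absorb1)
  next
    case 3
    then show ?thesis
      \<comment> \<open>The mirror image of the previous case, with \<open>a\<close>,
        \<open>g\<close> and \<open>b\<close>, \<open>k\<close> exchanged.\<close>
      using large[of h k g b a] pos assms by (simp add: max_absorb2 max.commute add.commute)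
  qed
qed

text \<open>Nothing can be matched, while the denominator is positive. A term equal to 1 makes the
  triangle inequality trivial, all distances being at most 1.\<close>

lemma d_e_eq_1_if_one_edgeless:
  assumes "finite (edges G)" "finite (edges H)" "(edges G = {}) \<noteq> (edges H = {})"
  shows "d_e G H = 1"
  using assms DMCES_le_left[of G H] DMCES_le_right[of G H] by (auto simp: d_e_def)

lemma d_e_triangle:
  fixes G H K :: "('v, 'l) labeled_digraph"
  assumes G: "G \<in> G_WSO" and H: "H \<in> G_WSO" and K: "K \<in> G_WSO"
  shows "d_e G K \<le> d_e G H + d_e H K"
proof -
  note fin = G_WSO_finite_edges[OF G] G_WSO_finite_edges[OF H] G_WSO_finite_edges[OF K]
  note bounds = d_e_bounds[OF fin(1), of K] d_e_bounds[OF fin(1), of H] d_e_bounds[OF fin(2), of K]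
  \<comment> \<open>The quotient formula serves only the last case; if all three graphs are
    edgeless, the 0/1 convention reduces the claim to transitivity of isomorphism.\<close>
  consider "edges G = {}" "edges H = {}" "edges K = {}"
    | "(edges G = {}) \<noteq> (edges H = {})" | "(edges H = {}) \<noteq> (edges K = {})"
    | "edges G \<noteq> {}" "edges H \<noteq> {}" "edges K \<noteq> {}"
    by blast
  then show ?thesis
  proof cases
    case 1
    then show ?thesis
      using labeled_iso_trans[OF G H K] by (simp add: d_e_def)
  next
    case 2
    then show ?thesis
      using d_e_eq_1_if_one_edgeless[OF fin(1,2)] bounds by linarith
  next
    case 3
    then show ?thesis
      using d_e_eq_1_if_one_edgeless[OF fin(2,3)] bounds by linarith
  next
    case 4
    then have "0 < card (edges G)" "0 < card (edges H)" "0 < card (edges K)"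
      using fin by (simp_all add: card_gt_0_iff)
    then have "DMCES G H / max (card (edges G)) (card (edges H))
        + DMCES H K / max (card (edges H)) (card (edges K))
        \<le> 1 + DMCES G K / max (card (edges G)) (card (edges K))"
      using DMCES_add_le[OF fin(1,2), of K]
        DMCES_le_right[OF fin(1,2)] DMCES_le_left[OF fin(2), of K]
      unfolding of_nat_max by (intro overlap_triangle) auto
    then show ?thesis
      using 4 by (simp add: d_e_def)
  qed
qed

text \<open>The usual pseudometric argument: moving either argument by distance 0 does not change
  the distance, by two triangle inequalities.\<close>

lemma d_e_labeled_iso_le:
  fixes G H G' H' :: "('v, 'l) labeled_digraph"
  assumes "G \<in> G_WSO" "H \<in> G_WSO" "G' \<in> G_WSO" "H' \<in> G_WSO"
    and "labeled_iso G G'" "labeled_iso H H'"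
  shows "d_e G H \<le> d_e G' H'"
proof -
  have "d_e G G' = 0" "d_e H' H = 0"
    using assms d_e_eq_0_iff d_e_commute by metis+
  then show ?thesis
    using d_e_triangle[of G G' H] d_e_triangle[of G' H' H] assms by linarith
qed

lemma d_e_cong_labeled_iso:
  fixes G H G' H' :: "('v, 'l) labeled_digraph"
  assumes "G \<in> G_WSO" "H \<in> G_WSO" "G' \<in> G_WSO" "H' \<in> G_WSO"
    and "labeled_iso G G'" "labeled_iso H H'"
  shows "d_e G H = d_e G' H'"
  using assms by (intro antisym d_e_labeled_iso_le) (auto intro: labeled_iso_sym)

section \<open>The metric on isomorphism classes\<close>

lemma some_in_iso_class:
  assumes "G \<in> G_WSO"
  shows "(SOME G'. G' \<in> iso_class G) \<in> G_WSO" "labeled_iso G (SOME G'. G' \<in> iso_class G)"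
proof -
  have "G \<in> iso_class G"
    unfolding iso_class_def using equiv_class_self[OF equiv_iso_rel assms] .
  then have "(SOME G'. G' \<in> iso_class G) \<in> iso_class G"
    by (rule someI)
  then show "(SOME G'. G' \<in> iso_class G) \<in> G_WSO" "labeled_iso G (SOME G'. G' \<in> iso_class G)"
    unfolding iso_class_def[of G] iso_rel_def by auto
qed

text \<open>Well-definedness: the representatives picked by \<open>SOME\<close> are isomorphic to
  \<open>G\<close> and \<open>H\<close>, so the choice does not affect the value.\<close>

lemma class_dist_iso_class:
  assumes "G \<in> G_WSO" "H \<in> G_WSO"
  shows "class_dist (iso_class G) (iso_class H) = d_e G H"
proof -
  have "iso_class G \<in> WSO_classes" "iso_class H \<in> WSO_classes"
    using assms by (auto simp: WSO_classes_def iso_class_def intro: quotientI)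
  then show ?thesis
    using d_e_cong_labeled_iso[OF assms some_in_iso_class(1)[OF assms(1)]
        some_in_iso_class(1)[OF assms(2)] some_in_iso_class(2)[OF assms(1)]
        some_in_iso_class(2)[OF assms(2)]]
    by (simp add: class_dist_def)
qed

lemma WSO_classes_cases:
  assumes "X \<in> WSO_classes"
  obtains G where "G \<in> G_WSO" "X = iso_class G"
  using assms by (auto simp: WSO_classes_def iso_class_def elim: quotientE)

lemma iso_class_eq_iff:
  assumes "G \<in> G_WSO" "H \<in> G_WSO"
  shows "iso_class G = iso_class H \<longleftrightarrow> labeled_iso G H"
  using eq_equiv_class_iff[OF equiv_iso_rel assms] assms by (simp add: iso_class_def iso_rel_def)

lemma Metric_space_class_dist:
  "Metric_space (WSO_classes :: ('v, 'l) labeled_digraph set set) class_dist"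
proof
  fix X Y :: "('v, 'l) labeled_digraph set"
  show "0 \<le> class_dist X Y"
  \<comment> \<open>This axiom and symmetry are demanded for arbitrary sets; off
    \<open>WSO_classes\<close> the default 0 settles both.\<close>
  proof (cases "X \<in> WSO_classes \<and> Y \<in> WSO_classes")
    case True
    then show ?thesis
      by (metis WSO_classes_cases class_dist_iso_class d_e_bounds(1) G_WSO_finite_edges)
  qed (auto simp: class_dist_def)
  show "class_dist X Y = class_dist Y X"
  proof (cases "X \<in> WSO_classes \<and> Y \<in> WSO_classes")
    case True
    then show ?thesis
      by (metis WSO_classes_cases class_dist_iso_class d_e_commute)
  qed (auto simp: class_dist_def)
next
  fix X Y :: "('v, 'l) labeled_digraph set"
  assume "X \<in> WSO_classes" "Y \<in> WSO_classes"
  then show "class_dist X Y = 0 \<longleftrightarrow> X = Y"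
    by (metis WSO_classes_cases class_dist_iso_class d_e_eq_0_iff iso_class_eq_iff)
next
  fix X Y Z :: "('v, 'l) labeled_digraph set"
  assume "X \<in> WSO_classes" "Y \<in> WSO_classes" "Z \<in> WSO_classes"
  then obtain G H K where "G \<in> G_WSO" "H \<in> G_WSO" "K \<in> G_WSO"
    "X = iso_class G" "Y = iso_class H" "Z = iso_class K"
    by (meson WSO_classes_cases)
  then show "class_dist X Z \<le> class_dist X Y + class_dist Y Z"
    by (simp add: class_dist_iso_class d_e_triangle)
qed

theorem theorem5p5:
  shows "(\<forall>G \<in> G_WSO. \<forall>G' \<in> (G_WSO :: ('v, 'l) labeled_digraph set).
            d_e G G' \<in> {0..1} \<and> class_dist (iso_class G) (iso_class G') = d_e G G') \<and>
         Metric_space (WSO_classes :: ('v, 'l) labeled_digraph set set) class_dist"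
  by (simp add: class_dist_iso_class d_e_bounds G_WSO_finite_edges Metric_space_class_dist)

end
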